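(* Let $\mathcal{P}=(\Sigma,\Theta_\Sigma,s_0,S_g)$ be a planning problem with edge cost estimation, with sub-optimality bound $\epsilon$. If every edge $e\in\mathcal{E}$ can be estimated using $\Theta(e)$ such that $c_{max}(e)/c_{min}(e)\le\epsilon$ (or $c_{min}(e)=c(e)=0$) holds, and a consistent heuristic $h(\cdot)$ is used, then ASEC is $\epsilon$-complete.
   Context: **Planning domain.** A planning domain is a tuple $\Sigma=(S,A,\gamma,c)$, where $S$ is a finite set of states, $A$ is a finite set of actions, $\gamma$ is the state-transition function and $c$ is a nonnegative action cost function, finite for applicable actions. Its digraph $\mathcal{G}_\Sigma$ has a vertex for each state in $S$ and edge set $\mathcal{E}$ consisting of all $e=(s,\gamma(s,a))$ with $a$ applicable in $s$. The edge cost is $c(e)=c(a)$. **Cost estimators.** A set of cost estimators for $\Sigma$ is $\Theta_\Sigma=\{\Theta(e):e\in\mathcal{E}\}$, where $\Theta(e)=\{\theta^e_1,\dots,\theta^e_{k(e)}\}$ with $k(e)\in\mathbb{N}$. When used, each $\theta_i^e$ returns bounds $c_{min}(\theta_i^e)\le c(e)\le c_{max}(\theta_i^e)$, and $0<c(e)<\infty$ implies $c_{min}(\theta_i^e)>0$ and $c_{max}(\theta_i^e)<\infty$. When more than one estimator of an edge is used, the tightest bounds found are kept; $c_{min}(e)$ and $c_{max}(e)$ denote the lower and upper bounds for $c(e)$ obtained in this way from $\Theta(e)$. Each estimator has a finite (unknown) running time. **Planning problem with edge cost estimation.** This is a tuple $(\Sigma,\Theta_\Sigma,s_0,S_g)$,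 where the cost function $c$ of $\Sigma$ is unknown, $s_0\in S$ is an initial state and $S_g\subset S$ is a set of goal states. A solution is a plan (finite action sequence) whose sequential application from $s_0$ ends in $S_g$. The cost $c(\pi)$ of a plan is the sum of its true action costs, and $c^*$ is the minimum cost over all solutions. For $\epsilon\ge1$, an $\epsilon$-optimal solution (or plan) is a solution $\pi$ with $c(\pi)\le c^*\times\epsilon$. **$\epsilon$-completeness.** An algorithm is $\epsilon$-complete if it guarantees to find an $\epsilon$-optimal plan, in case there exists a plan that can be verified to be $\epsilon$-optimal using the given set of estimators $\Theta_\Sigma$. **Heuristic.** $h$ is a parameterized heuristic: each edge cost function $\alpha:\mathcal{E}\to[0,\infty)$ gives a function $h_\alpha$ on nodes. It is consistent if, for every $\alpha$, $h_\alpha(n)\le\alpha((n,s))+h_\alpha(s)$ for every node $n$ and every successor $s$ of $n$, and $h_\alpha=0$ on goal nodes. ASEC uses $h=h_\alpha$, where $\alpha(e)$ is the lower bound given by the first estimator that $\mathsf{GetEstimator}(e)$ returns. **Algorithm ASEC** ($A^*$ with Synchronous Estimations of Costs). Input: the problem $\mathcal{P}$ and the target $\epsilon$. $\mathsf{GetEstimator}(e)$ returns an estimator from $\Theta(e)$ that has not yet been applied, or $\emptyset$ if none is left; nothing is assumed about the order in which estimators are returned. A ratio of an accumulated upper bound to an accumulated lower bound is considered to be $1$ when the lower bound is $0$. 1. Set $g_{min}(s_0)=g_{max}(s_0)=0$. OPEN and CLOSED are empty. Insert $s_0$ into OPEN with $f(s_0)=h(s_0)$. 2. While OPEN is nonempty: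 take from OPEN the best node $n$ (minimal $f$-value). If $n$ is a goal, return the plan obtained by tracing back from $n$ to $s_0$, together with $g_{max}(n)/g_{min}(n)$. Otherwise insert $n$ into CLOSED and, for each successor $s$ of $n$, do the following. - (a) If $s\notin$ OPEN $\cup$ CLOSED, set $g_{min}(s)=\infty$. - (b) Set $\eta_{eff}=\infty$, $\underline g=0$, $\theta=\mathsf{GetEstimator}((n,s))$. - (c) While $\eta_{eff}>\epsilon$ and $\underline g<g_{min}(s)$ and $\theta\ne\emptyset$: apply $\theta$ to obtain bounds $\underline c,\bar c$ of the cost of edge $(n,s)$ (keeping the tightest found so far); set $\underline g=g_{min}(n)+\underline c$, $\bar g=g_{max}(n)+\bar c$, $\eta_{eff}=\bar g/\underline g$, $\theta=\mathsf{GetEstimator}((n,s))$. - (d) If $\underline g<g_{min}(s)$: set $g_{min}(s)=\underline g$, $g_{max}(s)=\bar g$ (reached via $n$), remove $s$ from OPEN and CLOSED if present, and insert $s$ into OPEN with $f(s)=g_{min}(s)+h(s)$. 3. If OPEN becomes empty, return $(\emptyset,\infty)$. *)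

theory Defs
  imports "HOL-Library.Extended_Real"
begin

section \<open>Planning domains\<close>

text \<open>The transition function is partial: an action is applicable in a state iff a successor exists.\<close>

record ('s, 'a) planning_domain =
  states :: "'s set"
  actions :: "'a set"
  trans :: "'s \<Rightarrow> 'a \<Rightarrow> 's option"
  cost :: "'a \<Rightarrow> ereal"

definition induces :: "('s, 'a, 'z) planning_domain_scheme \<Rightarrow> 's \<Rightarrow> 'a \<Rightarrow> 's \<Rightarrow> bool" where
  "induces D s a t \<longleftrightarrow> s \<in> states D \<and> a \<in> actions D \<and> trans D s a = Some t"

definition edges :: "('s, 'a, 'z) planning_domain_scheme \<Rightarrow> ('s \<times> 's) set" where
  "edges D = {(s, t). \<exists>a. induces D s a t}"

definition edge_cost :: "('s, 'a, 'z) planning_domain_scheme \<Rightarrow> 's \<times> 's \<Rightarrow> ereal" where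
  "edge_cost D e = (THE x. \<exists>a. induces D (fst e) a (snd e) \<and> x = cost D a)"

text \<open>The last conjunct says that the edge cost given by the equation c(e) = c(a) is
  well defined when several actions induce the same edge.\<close>

definition is_planning_domain :: "('s, 'a, 'z) planning_domain_scheme \<Rightarrow> bool" where
  "is_planning_domain D \<longleftrightarrow>
     finite (states D) \<and> finite (actions D) \<and>
     (\<forall>s a t. induces D s a t \<longrightarrow> t \<in> states D) \<and>
     (\<forall>a\<in>actions D. 0 \<le> cost D a) \<and>
     (\<forall>s a t. induces D s a t \<longrightarrow> cost D a < \<infinity>) \<and>
     (\<forall>s a b t. induces D s a t \<and> induces D s b t \<longrightarrow> cost D a = cost D b)"


section \<open>Planning problems with edge cost estimation\<close>

record ('s, 'a, 't) est_problem = "('s, 'a) planning_domain" +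
  estimators :: "'s \<times> 's \<Rightarrow> 't set"
  est_min :: "'t \<Rightarrow> ereal"
  est_max :: "'t \<Rightarrow> ereal"
  init_state :: 's
  goals :: "'s set"

text \<open>An upper bound may be infinite on an edge of cost 0. Lower bounds are nonnegative,
  since they serve as edge costs for the heuristic.\<close>

definition are_cost_estimators :: "('s, 'a, 't) est_problem \<Rightarrow> bool" where
  "are_cost_estimators P \<longleftrightarrow>
     (\<forall>e\<in>edges P. finite (estimators P e) \<and>
        (\<forall>\<theta>\<in>estimators P e.
           0 \<le> est_min P \<theta> \<and> est_min P \<theta> \<le> edge_cost P e \<and> edge_cost P e \<le> est_max P \<theta> \<and>
           (0 < edge_cost P e \<and> edge_cost P e < \<infinity> \<longrightarrow> 0 < est_min P \<theta> \<and> est_max P \<theta> < \<infinity>)))"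

definition is_est_problem :: "('s, 'a, 't) est_problem \<Rightarrow> bool" where
  "is_est_problem P \<longleftrightarrow>
     is_planning_domain P \<and> are_cost_estimators P \<and>
     init_state P \<in> states P \<and> goals P \<subseteq> states P"

definition tightest_min :: "('s, 'a, 't) est_problem \<Rightarrow> 't set \<Rightarrow> ereal" where
  "tightest_min P T = (SUP \<theta>\<in>T. est_min P \<theta>)"

definition tightest_max :: "('s, 'a, 't) est_problem \<Rightarrow> 't set \<Rightarrow> ereal" where
  "tightest_max P T = (INF \<theta>\<in>T. est_max P \<theta>)"

definition edge_min :: "('s, 'a, 't) est_problem \<Rightarrow> 's \<times> 's \<Rightarrow> ereal" where
  "edge_min P e = tightest_min P (estimators P e)"

definition edge_max :: "('s, 'a, 't) est_problem \<Rightarrow> 's \<times> 's \<Rightarrow> ereal" where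
  "edge_max P e = tightest_max P (estimators P e)"


section \<open>Plans\<close>

fun leads_to :: "('s, 'a, 'z) planning_domain_scheme \<Rightarrow> 's \<Rightarrow> 'a list \<Rightarrow> 's \<Rightarrow> bool" where
  "leads_to D s [] t \<longleftrightarrow> s = t"
| "leads_to D s (a # as) t \<longleftrightarrow> (\<exists>u. induces D s a u \<and> leads_to D u as t)"

definition solution :: "('s, 'a, 't) est_problem \<Rightarrow> 'a list \<Rightarrow> bool" where
  "solution P \<pi> \<longleftrightarrow> (\<exists>t\<in>goals P. leads_to P (init_state P) \<pi> t)"

definition plan_cost :: "('s, 'a, 'z) planning_domain_scheme \<Rightarrow> 'a list \<Rightarrow> ereal" where
  "plan_cost D \<pi> = sum_list (map (cost D) \<pi>)"

text \<open>The infimum is attained if there is a solution: costs are nonnegative and the state set is finite.\<close>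

definition opt_cost :: "('s, 'a, 't) est_problem \<Rightarrow> ereal" where
  "opt_cost P = (INF \<pi>\<in>{\<pi>. solution P \<pi>}. plan_cost P \<pi>)"

definition eps_optimal :: "('s, 'a, 't) est_problem \<Rightarrow> real \<Rightarrow> 'a list \<Rightarrow> bool" where
  "eps_optimal P \<epsilon> \<pi> \<longleftrightarrow> solution P \<pi> \<and> plan_cost P \<pi> \<le> opt_cost P * ereal \<epsilon>"

text \<open>The true cost function is unknown; all that the estimators reveal is that it is one of
  the cost functions for which they are correct. A plan can thus be verified to be
  \<open>\<epsilon>\<close>-optimal iff it is \<open>\<epsilon>\<close>-optimal for each of these. This covers in particular every plan
  whose total upper bound is at most \<open>\<epsilon>\<close> times the smallest total lower bound of a solution.\<close>

definition verifiably_eps_optimal :: "('s, 'a, 't) est_problem \<Rightarrow> real \<Rightarrow> 'a list \<Rightarrow> bool" where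
  "verifiably_eps_optimal P \<epsilon> \<pi> \<longleftrightarrow>
     (\<forall>c. is_est_problem (P\<lparr>cost := c\<rparr>) \<longrightarrow> eps_optimal (P\<lparr>cost := c\<rparr>) \<epsilon> \<pi>)"

text \<open>A possibly nondeterministic algorithm is given by its initial configurations, its
  one-step relation, and the plan it outputs in a configuration, if any. It guarantees to
  find an \<open>\<epsilon>\<close>-optimal plan if each of its executions halts with such a plan as output.\<close>

definition guarantees_eps_optimal ::
  "('s, 'a, 't) est_problem \<Rightarrow> real \<Rightarrow> ('c \<Rightarrow> bool) \<Rightarrow> ('c \<Rightarrow> 'c \<Rightarrow> bool) \<Rightarrow> ('c \<Rightarrow> 'a list option) \<Rightarrow> bool" where
  "guarantees_eps_optimal P \<epsilon> initial step result \<longleftrightarrow>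
     \<not> (\<exists>\<rho>. initial (\<rho> 0) \<and> (\<forall>i::nat. step (\<rho> i) (\<rho> (Suc i)))) \<and>
     (\<forall>x y. initial x \<and> step\<^sup>*\<^sup>* x y \<and> \<not> (\<exists>z. step y z) \<longrightarrow>
        (\<exists>\<pi>. result y = Some \<pi> \<and> eps_optimal P \<epsilon> \<pi>))"

definition eps_complete ::
  "('s, 'a, 't) est_problem \<Rightarrow> real \<Rightarrow> ('c \<Rightarrow> bool) \<Rightarrow> ('c \<Rightarrow> 'c \<Rightarrow> bool) \<Rightarrow> ('c \<Rightarrow> 'a list option) \<Rightarrow> bool" where
  "eps_complete P \<epsilon> initial step result \<longleftrightarrow>
     ((\<exists>\<pi>. verifiably_eps_optimal P \<epsilon> \<pi>) \<longrightarrow> guarantees_eps_optimal P \<epsilon> initial step result)"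


section \<open>Heuristics\<close>

type_synonym 's param_heuristic = "('s \<times> 's \<Rightarrow> real) \<Rightarrow> 's \<Rightarrow> real"

definition consistent :: "('s, 'a, 't) est_problem \<Rightarrow> 's param_heuristic \<Rightarrow> bool" where
  "consistent P h \<longleftrightarrow>
     (\<forall>\<alpha>. (\<forall>e\<in>edges P. 0 \<le> \<alpha> e) \<longrightarrow>
        (\<forall>(n, s)\<in>edges P. h \<alpha> n \<le> \<alpha> (n, s) + h \<alpha> s) \<and> (\<forall>n\<in>goals P. h \<alpha> n = 0))"


section \<open>The algorithm ASEC\<close>

text \<open>\<open>applied e\<close> is the set of estimators of \<open>e\<close> applied so far, and \<open>asked\<close> is the set of
  edges for which an estimator has been requested. The value f(s) need not be stored: it is
  set whenever gmin(s) changes while s is in OPEN or CLOSED, so it always equals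
  gmin(s) + h(s).\<close>

record ('s, 't) asec_state =
  opn :: "'s set"
  clsd :: "'s set"
  gmin :: "'s \<Rightarrow> ereal"
  gmax :: "'s \<Rightarrow> ereal"
  parent :: "'s \<Rightarrow> 's"
  applied :: "'s \<times> 's \<Rightarrow> 't set"
  asked :: "('s \<times> 's) set"

text \<open>Control points: the head of the main loop; the loop over the successors of \<open>n\<close> still to
  be treated; the head of the estimation loop (c) for the edge \<open>(n, s)\<close>, with the values of
  the ratio, the two accumulated bounds, and the estimator to be applied next; and
  termination with a returned pair.\<close>

datatype ('s, 'a, 't) asec_config =
  Main "('s, 't) asec_state"
| Successors "('s, 't) asec_state" 's "'s set"
| Estimate "('s, 't) asec_state" 's "'s set" 's ereal ereal ereal "'t option"
| Return "'a list option" ereal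

definition ratio :: "ereal \<Rightarrow> ereal \<Rightarrow> ereal" where
  "ratio upper lower = (if lower = 0 then 1 else upper / lower)"

text \<open>The choice among the estimators not yet applied is arbitrary. Only the first estimator
  ever returned for an edge is given a name, \<open>first e\<close>, because the heuristic refers to it.\<close>

definition get_estimator ::
  "('s, 'a, 't) est_problem \<Rightarrow> ('s \<times> 's \<Rightarrow> 't) \<Rightarrow> ('s, 't) asec_state \<Rightarrow> 's \<times> 's \<Rightarrow> 't option \<Rightarrow> bool" where
  "get_estimator P first \<sigma> e r \<longleftrightarrow>
     (case r of
        None \<Rightarrow> estimators P e - applied \<sigma> e = {}
      | Some \<theta> \<Rightarrow> \<theta> \<in> estimators P e - applied \<sigma> e \<and> (e \<notin> asked \<sigma> \<longrightarrow> \<theta> = first e))"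

definition fval ::
  "('s, 'a, 't) est_problem \<Rightarrow> ('s \<times> 's \<Rightarrow> 't) \<Rightarrow> 's param_heuristic \<Rightarrow> ('s, 't) asec_state \<Rightarrow> 's \<Rightarrow> ereal" where
  "fval P first h \<sigma> n = gmin \<sigma> n + ereal (h (\<lambda>e. real_of_ereal (est_min P (first e))) n)"

definition best ::
  "('s, 'a, 't) est_problem \<Rightarrow> ('s \<times> 's \<Rightarrow> 't) \<Rightarrow> 's param_heuristic \<Rightarrow> ('s, 't) asec_state \<Rightarrow> 's \<Rightarrow> bool" where
  "best P first h \<sigma> n \<longleftrightarrow>
     n \<in> opn \<sigma> \<and> (\<forall>m\<in>opn \<sigma>. fval P first h \<sigma> n \<le> fval P first h \<sigma> m)"

inductive traced_plan :: "('s, 'a, 't) est_problem \<Rightarrow> ('s, 't) asec_state \<Rightarrow> 's \<Rightarrow> 'a list \<Rightarrow> bool"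
  for P \<sigma> where
  trace_start: "traced_plan P \<sigma> (init_state P) []"
| trace_back: "\<lbrakk>n \<noteq> init_state P; traced_plan P \<sigma> (parent \<sigma> n) \<pi>; induces P (parent \<sigma> n) a n\<rbrakk>
    \<Longrightarrow> traced_plan P \<sigma> n (\<pi> @ [a])"

text \<open>Components that the algorithm does not initialise have arbitrary values.\<close>

definition asec_initial :: "('s, 'a, 't) est_problem \<Rightarrow> ('s, 'a, 't) asec_config \<Rightarrow> bool" where
  "asec_initial P x \<longleftrightarrow>
     (\<exists>\<sigma>. x = Main \<sigma> \<and> opn \<sigma> = {init_state P} \<and> clsd \<sigma> = {} \<and>
        gmin \<sigma> (init_state P) = 0 \<and> gmax \<sigma> (init_state P) = 0 \<and>
        applied \<sigma> = (\<lambda>_. {}) \<and> asked \<sigma> = {})"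

text \<open>Ties between best nodes, the order of the successors, the results of GetEstimator, and the
  accumulated upper bound before the first estimation in step (c) (rule \<open>next_succ\<close>, where the
  algorithm does not initialise it) are all nondeterministic.\<close>

inductive asec_step ::
  "('s, 'a, 't) est_problem \<Rightarrow> real \<Rightarrow> ('s \<times> 's \<Rightarrow> 't) \<Rightarrow> 's param_heuristic
    \<Rightarrow> ('s, 'a, 't) asec_config \<Rightarrow> ('s, 'a, 't) asec_config \<Rightarrow> bool"
  for P \<epsilon> first h where
  no_plan:
    "opn \<sigma> = {} \<Longrightarrow> asec_step P \<epsilon> first h (Main \<sigma>) (Return None \<infinity>)"
| goal:
    "\<lbrakk>best P first h \<sigma> n; n \<in> goals P; traced_plan P \<sigma> n \<pi>\<rbrakk>
     \<Longrightarrow> asec_step P \<epsilon> first h (Main \<sigma>) (Return (Some \<pi>) (ratio (gmax \<sigma> n) (gmin \<sigma> n)))"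
| expand:
    "\<lbrakk>best P first h \<sigma> n; n \<notin> goals P\<rbrakk>
     \<Longrightarrow> asec_step P \<epsilon> first h (Main \<sigma>)
           (Successors (\<sigma>\<lparr>opn := opn \<sigma> - {n}, clsd := insert n (clsd \<sigma>)\<rparr>) n {s. (n, s) \<in> edges P})"
| end_succ:
    "asec_step P \<epsilon> first h (Successors \<sigma> n {}) (Main \<sigma>)"
| next_succ:
    "\<lbrakk>s \<in> R;
      \<sigma>' = (if s \<in> opn \<sigma> \<union> clsd \<sigma> then \<sigma> else \<sigma>\<lparr>gmin := (gmin \<sigma>)(s := \<infinity>)\<rparr>);
      get_estimator P first \<sigma>' (n, s) r\<rbrakk>
     \<Longrightarrow> asec_step P \<epsilon> first h (Successors \<sigma> n R)
           (Estimate (\<sigma>'\<lparr>asked := insert (n, s) (asked \<sigma>')\<rparr>) n (R - {s}) s \<infinity> 0 gu r)"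
| estimate:
    "\<lbrakk>ereal \<epsilon> < \<eta>; gl < gmin \<sigma> s;
      \<sigma>' = \<sigma>\<lparr>applied := (applied \<sigma>)((n, s) := insert \<theta> (applied \<sigma> (n, s)))\<rparr>;
      gl' = gmin \<sigma> n + tightest_min P (applied \<sigma>' (n, s));
      gu' = gmax \<sigma> n + tightest_max P (applied \<sigma>' (n, s));
      get_estimator P first \<sigma>' (n, s) r\<rbrakk>
     \<Longrightarrow> asec_step P \<epsilon> first h (Estimate \<sigma> n R s \<eta> gl gu (Some \<theta>))
           (Estimate (\<sigma>'\<lparr>asked := insert (n, s) (asked \<sigma>')\<rparr>) n R s (ratio gu' gl') gl' gu' r)"
| improve:
    "\<lbrakk>\<eta> \<le> ereal \<epsilon> \<or> r = None; gl < gmin \<sigma> s\<rbrakk>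
     \<Longrightarrow> asec_step P \<epsilon> first h (Estimate \<sigma> n R s \<eta> gl gu r)
           (Successors
              (\<sigma>\<lparr>gmin := (gmin \<sigma>)(s := gl), gmax := (gmax \<sigma>)(s := gu), parent := (parent \<sigma>)(s := n),
                 opn := insert s (opn \<sigma>), clsd := clsd \<sigma> - {s}\<rparr>) n R)"
| reject:
    "\<not> gl < gmin \<sigma> s
     \<Longrightarrow> asec_step P \<epsilon> first h (Estimate \<sigma> n R s \<eta> gl gu r) (Successors \<sigma> n R)"

fun asec_result :: "('s, 'a, 't) asec_config \<Rightarrow> 'a list option" where
  "asec_result (Return p b) = p"
| "asec_result _ = None"

end

theory Submission
  imports Defs
begin

text \<open>The lower bound used for an edge is at least the first one that was obtained, and the
  heuristic is consistent for the latter. Hence closed nodes are never reopened, as in \<open>A\<^sup>*\<close>: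
  each edge is treated once, with all its estimators unused, and the search is finite.
  Lower bounds never exceed true costs, so a goal node that is expanded has
  \<open>gmin \<le> c\<^sup>*\<close>. The true cost of the plan traced back from any node is at most \<open>\<epsilon> * gmin\<close>:
  the estimation of the last edge ended either with ratio at most \<open>\<epsilon>\<close>, or with
  all estimators applied, where the hypothesis on the edge bounds applies.\<close>

section \<open>Planning domains and estimators\<close>

lemma edge_cost_eq:
  assumes "is_planning_domain D" "induces D s a t"
  shows "edge_cost D (s, t) = cost D a"
  unfolding edge_cost_def
proof (rule the_equality)
  show "\<exists>b. induces D (fst (s, t)) b (snd (s, t)) \<and> cost D a = cost D b"
    using assms(2) by auto
next
  fix x assume "\<exists>b. induces D (fst (s, t)) b (snd (s, t)) \<and> x = cost D b"
  then show "x = cost D a"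
    using assms unfolding is_planning_domain_def by (metis fst_conv snd_conv)
qed

lemma edge_cost_bounds:
  assumes "is_planning_domain D" "e \<in> edges D"
  shows "0 \<le> edge_cost D e" "edge_cost D e < \<infinity>"
proof -
  obtain s t a where e: "e = (s, t)" "induces D s a t"
    using assms(2) by (auto simp: edges_def)
  then have "edge_cost D e = cost D a"
    using edge_cost_eq assms(1) by metis
  moreover have "a \<in> actions D" using e by (simp add: induces_def)
  ultimately show "0 \<le> edge_cost D e" "edge_cost D e < \<infinity>"
    using assms(1) e(2) unfolding is_planning_domain_def by metis+
qed

lemma edge_in_states:
  assumes "is_planning_domain D" "(s, t) \<in> edges D"
  shows "t \<in> states D"
  using assms unfolding is_planning_domain_def edges_def by auto

section \<open>Plans traced back along parent pointers\<close>

lemma leads_to_append: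
  "leads_to D s \<pi> u \<Longrightarrow> induces D u a t \<Longrightarrow> leads_to D s (\<pi> @ [a]) t"
  by (induction \<pi> arbitrary: s) auto

text \<open>\<open>D\<close> is closed under parents, so tracing back from a node of
  \<open>D\<close> never consults a pointer outside \<open>D\<close>. Thus the plans of old nodes
  survive pointer updates elsewhere.\<close>

lemma traced_plan_mono:
  assumes "traced_plan P \<sigma> m \<pi>" "m \<in> D"
    and "\<And>n. n \<in> D \<Longrightarrow> n \<noteq> init_state P \<Longrightarrow> parent \<sigma> n \<in> D \<and> parent \<sigma>' n = parent \<sigma> n"
  shows "traced_plan P \<sigma>' m \<pi>"
  using assms(1,2)
proof (induction rule: traced_plan.induct)
  case trace_start
  show ?case by (rule traced_plan.trace_start)
next
  case (trace_back n \<pi> a)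
  then show ?case using assms(3) by (metis traced_plan.trace_back)
qed

lemma traced_plan_cong:
  assumes "m \<in> D"
    and "\<And>n. n \<in> D \<Longrightarrow> n \<noteq> init_state P \<Longrightarrow> parent \<sigma> n \<in> D \<and> parent \<sigma>' n = parent \<sigma> n"
  shows "traced_plan P \<sigma>' m = traced_plan P \<sigma> m"
  using traced_plan_mono[of P \<sigma> m _ D \<sigma>'] traced_plan_mono[of P \<sigma>' m _ D \<sigma>] assms
  by fastforce

section \<open>Invariants of ASEC\<close>

text \<open>\<open>solvable\<close> stands in for the verifiable plan, which is in particular a
  solution under the true cost function.\<close>

locale solvable_estimation =
  fixes P :: "('s, 'a, 't) est_problem" and \<epsilon> :: real
    and h :: "'s param_heuristic" and first :: "'s \<times> 's \<Rightarrow> 't"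
  assumes problem: "is_est_problem P"
    and eps: "1 \<le> \<epsilon>"
    and estimable: "e \<in> edges P \<Longrightarrow> (0 < edge_min P e \<and> edge_max P e / edge_min P e \<le> ereal \<epsilon>)
                     \<or> (edge_min P e = 0 \<and> edge_cost P e = 0)"
    and consist: "consistent P h"
    and first: "e \<in> edges P \<Longrightarrow> first e \<in> estimators P e"
    and solvable: "\<exists>\<pi>. solution P \<pi>"
begin

abbreviation \<alpha> :: "'s \<times> 's \<Rightarrow> real" where
  "\<alpha> e \<equiv> real_of_ereal (est_min P (first e))"

abbreviation f :: "('s, 't) asec_state \<Rightarrow> 's \<Rightarrow> ereal" where
  "f \<equiv> fval P first h"

lemma domain: "is_planning_domain P"
  using problem by (simp add: is_est_problem_def)

lemma finite_states: "finite (states P)"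
  using domain by (simp add: is_planning_domain_def)

section \<open>Bounds given by the estimators and by the heuristic\<close>

lemma estimatorD:
  assumes "e \<in> edges P" "\<theta> \<in> estimators P e"
  shows "0 \<le> est_min P \<theta>" "est_min P \<theta> \<le> edge_cost P e" "edge_cost P e \<le> est_max P \<theta>"
    "est_min P \<theta> = 0 \<Longrightarrow> edge_cost P e = 0"
proof -
  show "0 \<le> est_min P \<theta>" "est_min P \<theta> \<le> edge_cost P e" "edge_cost P e \<le> est_max P \<theta>"
    using problem assms unfolding is_est_problem_def are_cost_estimators_def by auto
  show "edge_cost P e = 0" if "est_min P \<theta> = 0"
  proof -
    \<comment> \<open>A positive finite cost would force a positive lower bound; edge costs are
      finite and nonnegative, so only cost 0 remains.\<close>
    have "\<not> (0 < edge_cost P e \<and> edge_cost P e < \<infinity>)"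
      using problem assms that unfolding is_est_problem_def are_cost_estimators_def by fastforce
    then show ?thesis using edge_cost_bounds[OF domain assms(1)] by force
  qed
qed

text \<open>The first lower bound lies below a finite true cost, so \<open>real_of_ereal\<close>
  loses nothing and consistency may be applied to \<alpha>.\<close>

lemma \<alpha>:
  assumes "e \<in> edges P"
  shows "ereal (\<alpha> e) = est_min P (first e)" "0 \<le> \<alpha> e"
proof -
  have "0 \<le> est_min P (first e)" "est_min P (first e) < \<infinity>"
    using estimatorD[OF assms first[OF assms]] edge_cost_bounds[OF domain assms]
    by (auto intro: le_less_trans)
  then show "ereal (\<alpha> e) = est_min P (first e)" "0 \<le> \<alpha> e"
    by (auto simp: ereal_real' real_of_ereal_pos)
qed

lemma heuristic_edge: "(n, s) \<in> edges P \<Longrightarrow> h \<alpha> n \<le> \<alpha> (n, s) + h \<alpha> s"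
  and heuristic_goal: "n \<in> goals P \<Longrightarrow> h \<alpha> n = 0"
  using consist \<alpha>(2) unfolding consistent_def by (metis (no_types, lifting) case_prodD)+

text \<open>Consistency telescopes along the plan down to the value 0 at the goal, and \<alpha>
  never exceeds the true edge cost.\<close>

lemma heuristic_admissible:
  assumes "leads_to P m \<pi> t" "t \<in> goals P"
  shows "ereal (h \<alpha> m) \<le> plan_cost P \<pi>"
  using assms(1)
proof (induction \<pi> arbitrary: m)
  case Nil
  then show ?case using heuristic_goal assms(2) by (simp add: plan_cost_def zero_ereal_def)
next
  case (Cons a \<pi>)
  then obtain u where u: "induces P m a u" "leads_to P u \<pi> t" by auto
  then have e: "(m, u) \<in> edges P" by (auto simp: edges_def)
  have "ereal (h \<alpha> m) \<le> ereal (\<alpha> (m, u)) + ereal (h \<alpha> u)"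
    using heuristic_edge[OF e] by simp
  also have "\<dots> \<le> cost P a + plan_cost P \<pi>"
    using \<alpha>(1)[OF e] estimatorD(2)[OF e first[OF e]] edge_cost_eq[OF domain u(1)] Cons.IH[OF u(2)]
    by (intro add_mono) auto
  finally show ?case by (simp add: plan_cost_def)
qed

text \<open>Having \<open>first e\<close> in \<open>T\<close> excludes the value minus infinity of
  an empty supremum and ties the bound to the edge costs that the heuristic sees.\<close>

lemma tightest_bounds:
  assumes "e \<in> edges P" "T \<subseteq> estimators P e" "first e \<in> T"
  shows "ereal (\<alpha> e) \<le> tightest_min P T" "0 \<le> tightest_min P T"
    "tightest_min P T \<le> edge_cost P e" "edge_cost P e \<le> tightest_max P T"
    "tightest_min P T = 0 \<Longrightarrow> edge_cost P e = 0"
proof -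
  have *: "est_min P (first e) \<le> tightest_min P T"
    using assms(3) by (auto simp: tightest_min_def intro: SUP_upper)
  then show "ereal (\<alpha> e) \<le> tightest_min P T"
    using \<alpha>[OF assms(1)] by simp
  show "0 \<le> tightest_min P T"
    using * estimatorD(1)[OF assms(1) first[OF assms(1)]] by simp
  show "tightest_min P T \<le> edge_cost P e"
    unfolding tightest_min_def using estimatorD(2)[OF assms(1)] assms(2) by (auto intro!: SUP_least)
  show "edge_cost P e \<le> tightest_max P T"
    unfolding tightest_max_def using estimatorD(3)[OF assms(1)] assms(2) by (auto intro!: INF_greatest)
  show "edge_cost P e = 0" if "tightest_min P T = 0"
    using * that estimatorD(1,4)[OF assms(1) first[OF assms(1)]] by simp
qed

text \<open>The hypothesis on edge bounds enters here: a positive lower bound gives cost \<le>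
  \<open>edge_max\<close> \<le> \<epsilon> * \<open>edge_min\<close>, and otherwise both sides
  vanish.\<close>

lemma edge_cost_le_edge_min:
  assumes "e \<in> edges P"
  shows "edge_cost P e \<le> ereal \<epsilon> * edge_min P e"
proof (cases "0 < edge_min P e")
  case True
  have b: "edge_min P e \<le> edge_cost P e" "edge_cost P e \<le> edge_max P e"
    using tightest_bounds[OF assms subset_refl first[OF assms]]
    by (auto simp: edge_min_def edge_max_def)
  then have "edge_min P e < \<infinity>"
    using edge_cost_bounds[OF domain assms] by (auto intro: le_less_trans)
  then have "edge_max P e \<le> ereal \<epsilon> * edge_min P e"
    using True estimable[OF assms] ereal_divide_le_pos[of "edge_min P e" "edge_max P e" "ereal \<epsilon>"]
    by (auto simp: mult.commute)
  then show ?thesis using b by (auto intro: order_trans)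
next
  case False
  then show ?thesis using estimable[OF assms] by auto
qed

text \<open>The two upper bounds on the traced cost serve different exits of the estimation loop:
  \<open>gmax\<close> is needed when the ratio drops to \<open>\<epsilon>\<close>, and \<open>\<epsilon> * gmin\<close> when the estimators are
  exhausted, since \<open>gmax\<close> may then exceed \<open>\<epsilon> * gmin\<close> (it can even be infinite).\<close>

definition sound_node :: "('s, 't) asec_state \<Rightarrow> 's \<Rightarrow> bool" where
  "sound_node \<sigma> m \<longleftrightarrow>
     0 \<le> gmin \<sigma> m \<and> gmin \<sigma> m < \<infinity> \<and>
     (m \<noteq> init_state P \<longrightarrow> parent \<sigma> m \<in> clsd \<sigma>) \<and>
     (\<exists>\<pi>. traced_plan P \<sigma> m \<pi>) \<and>
     (\<forall>\<pi>. traced_plan P \<sigma> m \<pi> \<longrightarrow>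
        leads_to P (init_state P) \<pi> m \<and>
        plan_cost P \<pi> \<le> gmax \<sigma> m \<and> plan_cost P \<pi> \<le> ereal \<epsilon> * gmin \<sigma> m)"

text \<open>\<open>U\<close> contains the edges from closed nodes for which no estimator was requested yet, and
  \<open>V\<close> those that have not been completely treated.\<close>

definition search_inv :: "('s, 't) asec_state \<Rightarrow> ('s \<times> 's) set \<Rightarrow> ('s \<times> 's) set \<Rightarrow> bool" where
  "search_inv \<sigma> U V \<longleftrightarrow>
     opn \<sigma> \<union> clsd \<sigma> \<subseteq> states P \<and> opn \<sigma> \<inter> clsd \<sigma> = {} \<and> clsd \<sigma> \<inter> goals P = {} \<and>
     init_state P \<in> opn \<sigma> \<union> clsd \<sigma> \<and> gmin \<sigma> (init_state P) = 0 \<and>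
     (\<forall>m\<in>opn \<sigma> \<union> clsd \<sigma>. sound_node \<sigma> m) \<and>
     (\<forall>m s. m \<notin> clsd \<sigma> \<or> (m, s) \<in> U \<longrightarrow> applied \<sigma> (m, s) = {} \<and> (m, s) \<notin> asked \<sigma>) \<and>
     (\<forall>m\<in>clsd \<sigma>. \<forall>s. (m, s) \<in> edges P - V \<longrightarrow>
        s \<in> opn \<sigma> \<union> clsd \<sigma> \<and> gmin \<sigma> s \<le> gmin \<sigma> m + edge_cost P (m, s))"

text \<open>Here \<open>n\<close> is the node being expanded, the last one closed. The condition
  records that nodes are closed in order of nondecreasing f-value.\<close>

definition frontier :: "('s, 't) asec_state \<Rightarrow> 's \<Rightarrow> bool" where
  "frontier \<sigma> n \<longleftrightarrow> n \<in> clsd \<sigma> \<and> (\<forall>m\<in>clsd \<sigma>. f \<sigma> m \<le> f \<sigma> n) \<and> (\<forall>m\<in>opn \<sigma>. f \<sigma> n \<le> f \<sigma> m)"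

text \<open>The first disjunct holds before the first estimation.\<close>

definition estimation_inv ::
  "('s, 't) asec_state \<Rightarrow> 's \<times> 's \<Rightarrow> ereal \<Rightarrow> ereal \<Rightarrow> ereal \<Rightarrow> 't option \<Rightarrow> bool" where
  "estimation_inv \<sigma> e \<eta> gl gu r \<longleftrightarrow>
     e \<in> edges P \<and> e \<in> asked \<sigma> \<and> applied \<sigma> e \<subseteq> estimators P e \<and> get_estimator P first \<sigma> e r \<and>
     (snd e \<in> opn \<sigma> \<union> clsd \<sigma> \<or> gmin \<sigma> (snd e) = \<infinity>) \<and>
     (\<eta> = \<infinity> \<and> gl = 0 \<and> r = Some (first e) \<or>
      first e \<in> applied \<sigma> e \<and>
      gl = gmin \<sigma> (fst e) + tightest_min P (applied \<sigma> e) \<and>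
      gu = gmax \<sigma> (fst e) + tightest_max P (applied \<sigma> e) \<and> \<eta> = ratio gu gl)"

text \<open>During the estimation of \<open>(n, s)\<close> this edge has left \<open>U\<close>,
  since an estimator was requested, but it stays in \<open>V\<close>, since \<open>gmin\<close> at
  \<open>s\<close> has not been settled yet. On \<open>Return\<close> the invariant is the desired
  conclusion itself.\<close>

fun config_inv :: "('s, 'a, 't) asec_config \<Rightarrow> bool" where
  "config_inv (Main \<sigma>) \<longleftrightarrow>
     search_inv \<sigma> {} {} \<and> (\<forall>m\<in>clsd \<sigma>. \<forall>n\<in>opn \<sigma>. f \<sigma> m \<le> f \<sigma> n)"
| "config_inv (Successors \<sigma> n R) \<longleftrightarrow>
     search_inv \<sigma> ({n} \<times> R) ({n} \<times> R) \<and> frontier \<sigma> n \<and> R \<subseteq> {s. (n, s) \<in> edges P}"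
| "config_inv (Estimate \<sigma> n R s \<eta> gl gu r) \<longleftrightarrow>
     search_inv \<sigma> ({n} \<times> R) ({n} \<times> insert s R) \<and> frontier \<sigma> n \<and> R \<subseteq> {s. (n, s) \<in> edges P} \<and>
     s \<notin> R \<and> estimation_inv \<sigma> (n, s) \<eta> gl gu r"
| "config_inv (Return p b) \<longleftrightarrow> (\<exists>\<pi>. p = Some \<pi> \<and> eps_optimal P \<epsilon> \<pi>)"

lemma search_invD:
  assumes "search_inv \<sigma> U V"
  shows "opn \<sigma> \<union> clsd \<sigma> \<subseteq> states P" "opn \<sigma> \<inter> clsd \<sigma> = {}" "clsd \<sigma> \<inter> goals P = {}"
    "init_state P \<in> opn \<sigma> \<union> clsd \<sigma>" "gmin \<sigma> (init_state P) = 0"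
    "\<And>m. m \<in> opn \<sigma> \<union> clsd \<sigma> \<Longrightarrow> sound_node \<sigma> m"
    "\<And>m s. m \<notin> clsd \<sigma> \<or> (m, s) \<in> U \<Longrightarrow> applied \<sigma> (m, s) = {} \<and> (m, s) \<notin> asked \<sigma>"
    "\<And>m s. m \<in> clsd \<sigma> \<Longrightarrow> (m, s) \<in> edges P - V \<Longrightarrow>
        s \<in> opn \<sigma> \<union> clsd \<sigma> \<and> gmin \<sigma> s \<le> gmin \<sigma> m + edge_cost P (m, s)"
  using assms unfolding search_inv_def by blast+

lemma search_invI:
  assumes "opn \<sigma> \<union> clsd \<sigma> \<subseteq> states P" "opn \<sigma> \<inter> clsd \<sigma> = {}" "clsd \<sigma> \<inter> goals P = {}"
    "init_state P \<in> opn \<sigma> \<union> clsd \<sigma>" "gmin \<sigma> (init_state P) = 0"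
    "\<And>m. m \<in> opn \<sigma> \<union> clsd \<sigma> \<Longrightarrow> sound_node \<sigma> m"
    "\<And>m s. m \<notin> clsd \<sigma> \<or> (m, s) \<in> U \<Longrightarrow> applied \<sigma> (m, s) = {} \<and> (m, s) \<notin> asked \<sigma>"
    "\<And>m s. m \<in> clsd \<sigma> \<Longrightarrow> (m, s) \<in> edges P - V \<Longrightarrow>
        s \<in> opn \<sigma> \<union> clsd \<sigma> \<and> gmin \<sigma> s \<le> gmin \<sigma> m + edge_cost P (m, s)"
  shows "search_inv \<sigma> U V"
  using assms unfolding search_inv_def by blast

lemma search_inv_node:
  assumes "search_inv \<sigma> U V" "m \<in> opn \<sigma> \<union> clsd \<sigma>"
  shows "sound_node \<sigma> m" "0 \<le> gmin \<sigma> m" "gmin \<sigma> m < \<infinity>"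
    "m \<noteq> init_state P \<Longrightarrow> parent \<sigma> m \<in> clsd \<sigma>"
  using assms unfolding search_inv_def sound_node_def by auto

text \<open>\<open>X\<close> holds the nodes whose data may change. Parents are closed and
  \<open>X\<close> contains no closed node, so tracing back from \<open>m\<close> avoids
  \<open>X\<close>.\<close>

lemma sound_node_cong:
  assumes inv: "search_inv \<sigma> U V" and m: "m \<in> opn \<sigma> \<union> clsd \<sigma>" "m \<notin> X" "X \<inter> clsd \<sigma> = {}"
    and eq: "clsd \<sigma>' = clsd \<sigma>"
      "\<And>k. k \<notin> X \<Longrightarrow> k \<in> opn \<sigma> \<union> clsd \<sigma> \<Longrightarrow>
        gmin \<sigma>' k = gmin \<sigma> k \<and> gmax \<sigma>' k = gmax \<sigma> k \<and> parent \<sigma>' k = parent \<sigma> k"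
  shows "sound_node \<sigma>' m"
proof -
  have "traced_plan P \<sigma>' m = traced_plan P \<sigma> m"
    by (rule traced_plan_cong[where D = "opn \<sigma> \<union> clsd \<sigma> - X"])
      (use m eq search_inv_node(4)[OF inv] in auto)
  then show ?thesis
    using search_inv_node(1)[OF inv m(1)] eq(1) eq(2)[OF m(2,1)] unfolding sound_node_def by auto
qed

section \<open>Optimality of the returned plan\<close>

text \<open>Walk along the solution until it meets OPEN. Each step out of a closed node raises
  \<open>gmin\<close> by at most the true edge cost, and at the open node admissibility bounds the
  rest.\<close>

lemma open_node_below_solution:
  assumes inv: "search_inv \<sigma> {} {}" and "m \<in> opn \<sigma> \<union> clsd \<sigma>"
    and "leads_to P m \<pi> t" and t: "t \<in> goals P"
  shows "\<exists>n\<in>opn \<sigma>. f \<sigma> n \<le> gmin \<sigma> m + plan_cost P \<pi>"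
  using assms(2,3)
proof (induction \<pi> arbitrary: m)
  case Nil
  \<comment> \<open>Goals are never closed, so a walk that ends at a goal has met OPEN at the latest
    there.\<close>
  then have "m \<in> opn \<sigma>" "m \<in> goals P" using inv t unfolding search_inv_def by auto
  then show ?case
    using heuristic_goal by (intro bexI[of _ m]) (auto simp: fval_def plan_cost_def zero_ereal_def[symmetric])
next
  case (Cons a \<pi>)
  show ?case
  proof (cases "m \<in> opn \<sigma>")
    case True
    then show ?thesis
      using heuristic_admissible[OF Cons.prems(2) t] by (auto simp: fval_def intro!: bexI add_left_mono)
  next
    case False
    then have m: "m \<in> clsd \<sigma>" using Cons.prems by auto
    obtain u where u: "induces P m a u" "leads_to P u \<pi> t" using Cons.prems by auto
    then have "(m, u) \<in> edges P" by (auto simp: edges_def)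
    then have "u \<in> opn \<sigma> \<union> clsd \<sigma>" and le: "gmin \<sigma> u \<le> gmin \<sigma> m + cost P a"
      using search_invD(8)[OF inv m, of u] edge_cost_eq[OF domain u(1)] by auto
    then obtain n where "n \<in> opn \<sigma>" "f \<sigma> n \<le> gmin \<sigma> u + plan_cost P \<pi>"
      using Cons.IH u by blast
    moreover have "gmin \<sigma> u + plan_cost P \<pi> \<le> gmin \<sigma> m + plan_cost P (a # \<pi>)"
      using add_right_mono[OF le, of "plan_cost P \<pi>"] by (simp add: plan_cost_def add.assoc)
    ultimately show ?thesis by (auto intro: order_trans)
  qed
qed

lemma best_below_solution:
  assumes inv: "search_inv \<sigma> {} {}" and "solution P \<pi>"
  shows "\<exists>n\<in>opn \<sigma>. f \<sigma> n \<le> plan_cost P \<pi>"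
proof -
  obtain t where "t \<in> goals P" "leads_to P (init_state P) \<pi> t"
    using assms by (auto simp: solution_def)
  moreover have "init_state P \<in> opn \<sigma> \<union> clsd \<sigma>" "gmin \<sigma> (init_state P) = 0"
    using inv by (auto simp: search_inv_def)
  ultimately show ?thesis using open_node_below_solution[OF inv] by force
qed

text \<open>At a goal h is 0, so \<open>gmin\<close> equals the minimal f-value in OPEN, which is at
  most the cost of every solution. Soundness of the node supplies the factor \<epsilon>.\<close>

lemma returned_plan_eps_optimal:
  assumes inv: "search_inv \<sigma> {} {}" and n: "best P first h \<sigma> n" "n \<in> goals P"
    and \<pi>: "traced_plan P \<sigma> n \<pi>"
  shows "eps_optimal P \<epsilon> \<pi>"
proof -
  have op: "n \<in> opn \<sigma>" using n by (simp add: best_def)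
  then have "sound_node \<sigma> n" using search_inv_node[OF inv] by auto
  then have s: "leads_to P (init_state P) \<pi> n" "plan_cost P \<pi> \<le> ereal \<epsilon> * gmin \<sigma> n"
    using \<pi> by (auto simp: sound_node_def)
  have "gmin \<sigma> n = f \<sigma> n" using heuristic_goal[OF n(2)] by (simp add: fval_def zero_ereal_def[symmetric])
  also have "f \<sigma> n \<le> opt_cost P"
    unfolding opt_cost_def
  proof (rule INF_greatest)
    fix \<pi>' assume "\<pi>' \<in> {\<pi>. solution P \<pi>}"
    then obtain m where "m \<in> opn \<sigma>" "f \<sigma> m \<le> plan_cost P \<pi>'"
      using best_below_solution[OF inv] by blast
    then show "f \<sigma> n \<le> plan_cost P \<pi>'" using n(1) by (auto simp: best_def intro: order_trans)
  qed
  finally have "ereal \<epsilon> * gmin \<sigma> n \<le> opt_cost P * ereal \<epsilon>"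
    using eps by (subst mult.commute[of "opt_cost P"], intro ereal_mult_left_mono) auto
  then show ?thesis using s n(2) unfolding eps_optimal_def solution_def by (auto intro: order_trans)
qed

section \<open>Preservation of the invariants by the steps of the algorithm\<close>

lemma initial_config_inv:
  assumes "asec_initial P x"
  shows "config_inv x"
proof -
  obtain \<sigma> where \<sigma>: "x = Main \<sigma>" "opn \<sigma> = {init_state P}" "clsd \<sigma> = {}"
    "gmin \<sigma> (init_state P) = 0" "gmax \<sigma> (init_state P) = 0"
    "applied \<sigma> = (\<lambda>_. {})" "asked \<sigma> = {}"
    using assms by (auto simp: asec_initial_def)
  have "traced_plan P \<sigma> (init_state P) \<pi> \<longleftrightarrow> \<pi> = []" for \<pi>
    by (auto elim: traced_plan.cases intro: traced_plan.intros)
  then have "sound_node \<sigma> (init_state P)"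
    using \<sigma> by (simp add: sound_node_def plan_cost_def)
  then show ?thesis
    using \<sigma> problem by (auto simp: search_inv_def is_est_problem_def)
qed

lemma f_cong: "gmin \<sigma>' m = gmin \<sigma> m \<Longrightarrow> f \<sigma>' m = f \<sigma> m"
  by (simp add: fval_def)

text \<open>Before the step \<open>n\<close> was not closed, so its outgoing edges are still
  untouched, as \<open>U\<close> demands; all of them are in \<open>V\<close>, so nothing about
  their targets has to be shown yet.\<close>

lemma expand_inv:
  assumes inv: "config_inv (Main \<sigma>)" and n: "best P first h \<sigma> n" "n \<notin> goals P"
  shows "config_inv (Successors (\<sigma>\<lparr>opn := opn \<sigma> - {n}, clsd := insert n (clsd \<sigma>)\<rparr>) n {s. (n, s) \<in> edges P})"
    (is "config_inv (Successors ?\<sigma> n ?R)")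
proof -
  have s: "search_inv \<sigma> {} {}" and op: "n \<in> opn \<sigma>" "\<And>m. m \<in> opn \<sigma> \<Longrightarrow> f \<sigma> n \<le> f \<sigma> m"
    and cl: "n \<notin> clsd \<sigma>" "\<And>m. m \<in> clsd \<sigma> \<Longrightarrow> f \<sigma> m \<le> f \<sigma> n"
    using inv n by (auto simp: best_def search_inv_def)
  have f: "f ?\<sigma> = f \<sigma>" by (simp add: fun_eq_iff fval_def)
  have t: "traced_plan P ?\<sigma> m = traced_plan P \<sigma> m" for m
    by (rule traced_plan_cong[where D = UNIV]) auto
  have "sound_node ?\<sigma> m" if "m \<in> opn \<sigma> \<union> clsd \<sigma>" for m
    using search_inv_node(1)[OF s that] by (auto simp: sound_node_def t)
  then have "search_inv ?\<sigma> ({n} \<times> ?R) ({n} \<times> ?R)"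
    using s op(1) cl(1) n(2) unfolding search_inv_def by auto
  moreover have "frontier ?\<sigma> n"
    using op cl unfolding frontier_def f by auto
  ultimately show ?thesis by simp
qed

lemma next_succ_inv:
  assumes inv: "config_inv (Successors \<sigma> n R)" and s: "s \<in> R"
    and \<sigma>': "\<sigma>' = (if s \<in> opn \<sigma> \<union> clsd \<sigma> then \<sigma> else \<sigma>\<lparr>gmin := (gmin \<sigma>)(s := \<infinity>)\<rparr>)"
    and r: "get_estimator P first \<sigma>' (n, s) r"
  shows "config_inv (Estimate (\<sigma>'\<lparr>asked := insert (n, s) (asked \<sigma>')\<rparr>) n (R - {s}) s \<infinity> 0 gu r)"
    (is "config_inv (Estimate ?\<sigma> _ _ _ _ _ _ _)")
proof -
  have si: "search_inv \<sigma> ({n} \<times> R) ({n} \<times> R)" and fr: "frontier \<sigma> n"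
    and R: "R \<subseteq> {s. (n, s) \<in> edges P}" using inv by auto
  then have n: "n \<in> clsd \<sigma>" and e: "(n, s) \<in> edges P" using s by (auto simp: frontier_def)
  have eq: "opn ?\<sigma> = opn \<sigma>" "clsd ?\<sigma> = clsd \<sigma>" "gmax ?\<sigma> = gmax \<sigma>" "parent ?\<sigma> = parent \<sigma>"
    "applied ?\<sigma> = applied \<sigma>" "asked ?\<sigma> = insert (n, s) (asked \<sigma>)"
    and g: "\<And>m. m \<in> opn \<sigma> \<union> clsd \<sigma> \<Longrightarrow> gmin ?\<sigma> m = gmin \<sigma> m"
    and g': "s \<in> opn \<sigma> \<union> clsd \<sigma> \<or> gmin ?\<sigma> s = \<infinity>"
    by (auto simp: \<sigma>')
  have f: "\<And>m. m \<in> opn \<sigma> \<union> clsd \<sigma> \<Longrightarrow> f ?\<sigma> m = f \<sigma> m"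
    using g f_cong by blast
  have sn: "sound_node ?\<sigma> m" if "m \<in> opn \<sigma> \<union> clsd \<sigma>" for m
    by (rule sound_node_cong[OF si that, where X = "{}"]) (use eq g in auto)
  have ii: "init_state P \<in> opn \<sigma> \<union> clsd \<sigma>" using si by (auto simp: search_inv_def)
  have cl: "\<forall>m\<in>clsd \<sigma>. \<forall>u. (m, u) \<in> edges P - {n} \<times> R \<longrightarrow>
        u \<in> opn \<sigma> \<union> clsd \<sigma> \<and> gmin ?\<sigma> u \<le> gmin ?\<sigma> m + edge_cost P (m, u)"
    using si g unfolding search_inv_def by auto
  \<comment> \<open>Requesting an estimator removes \<open>(n, s)\<close> from \<open>U\<close>
    only; \<open>V\<close> is still \<open>{n} \<times> R\<close>.\<close>
  have "search_inv ?\<sigma> ({n} \<times> (R - {s})) ({n} \<times> insert s (R - {s}))"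
    unfolding insert_Diff[OF s]
  proof (rule search_invI, unfold eq g[OF ii])
    show "applied \<sigma> (m, u) = {} \<and> (m, u) \<notin> insert (n, s) (asked \<sigma>)"
      if "m \<notin> clsd \<sigma> \<or> (m, u) \<in> {n} \<times> (R - {s})" for m u
    proof -
      have "(m, u) \<noteq> (n, s)" "m \<notin> clsd \<sigma> \<or> (m, u) \<in> {n} \<times> R" using that n by blast+
      then show ?thesis using search_invD(7)[OF si, of m u] by blast
    qed
  qed (use search_invD(1-5)[OF si] sn cl in simp_all)
  moreover have "frontier ?\<sigma> n"
    using fr f unfolding frontier_def eq by auto
  moreover have "applied \<sigma> (n, s) = {}" "(n, s) \<notin> asked \<sigma>"
    using si s unfolding search_inv_def by auto
  moreover from this have "applied \<sigma>' (n, s) = {}" "(n, s) \<notin> asked \<sigma>'"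
    by (auto simp: \<sigma>')
  \<comment> \<open>No estimator has been applied, so \<open>None\<close> is impossible, and the
    first request for an edge must return \<open>first\<close>.\<close>
  then have "r = Some (first (n, s))"
    using r first[OF e] by (auto simp: get_estimator_def split: option.splits)
  moreover from this have "get_estimator P first ?\<sigma> (n, s) r"
    using r by (simp add: get_estimator_def)
  ultimately show ?thesis
    using R e g' by (auto simp: estimation_inv_def eq)
qed

lemma estimate_inv:
  assumes inv: "config_inv (Estimate \<sigma> n R s \<eta> gl gu (Some \<theta>))"
    and \<sigma>': "\<sigma>' = \<sigma>\<lparr>applied := (applied \<sigma>)((n, s) := insert \<theta> (applied \<sigma> (n, s)))\<rparr>"
    and gl': "gl' = gmin \<sigma> n + tightest_min P (applied \<sigma>' (n, s))"
    and gu': "gu' = gmax \<sigma> n + tightest_max P (applied \<sigma>' (n, s))"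
    and r: "get_estimator P first \<sigma>' (n, s) r"
  shows "config_inv (Estimate (\<sigma>'\<lparr>asked := insert (n, s) (asked \<sigma>')\<rparr>) n R s (ratio gu' gl') gl' gu' r)"
    (is "config_inv (Estimate ?\<sigma> _ _ _ _ _ _ _)")
proof -
  have si: "search_inv \<sigma> ({n} \<times> R) ({n} \<times> insert s R)" and fr: "frontier \<sigma> n"
    and R: "R \<subseteq> {s. (n, s) \<in> edges P}" "s \<notin> R"
    and es: "estimation_inv \<sigma> (n, s) \<eta> gl gu (Some \<theta>)" using inv by auto
  have n: "n \<in> clsd \<sigma>" using fr by (simp add: frontier_def)
  have eq: "opn ?\<sigma> = opn \<sigma>" "clsd ?\<sigma> = clsd \<sigma>" "gmin ?\<sigma> = gmin \<sigma>" "gmax ?\<sigma> = gmax \<sigma>"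
    "parent ?\<sigma> = parent \<sigma>" "asked ?\<sigma> = insert (n, s) (asked \<sigma>)"
    "applied ?\<sigma> = (applied \<sigma>)((n, s) := insert \<theta> (applied \<sigma> (n, s)))"
    by (auto simp: \<sigma>')
  have sn: "sound_node ?\<sigma> m" if "m \<in> opn \<sigma> \<union> clsd \<sigma>" for m
    by (rule sound_node_cong[OF si that, where X = "{}"]) (use eq in auto)
  have "search_inv ?\<sigma> ({n} \<times> R) ({n} \<times> insert s R)"
  proof (rule search_invI, unfold eq)
    show "((applied \<sigma>)((n, s) := insert \<theta> (applied \<sigma> (n, s)))) (m, u) = {} \<and>
        (m, u) \<notin> insert (n, s) (asked \<sigma>)"
      if "m \<notin> clsd \<sigma> \<or> (m, u) \<in> {n} \<times> R" for m u
    proof -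
      have "(m, u) \<noteq> (n, s)" using that n R(2) by blast
      then show ?thesis using search_invD(7)[OF si that] by simp
    qed
    show "u \<in> opn \<sigma> \<union> clsd \<sigma> \<and> gmin \<sigma> u \<le> gmin \<sigma> m + edge_cost P (m, u)"
      if "m \<in> clsd \<sigma>" "(m, u) \<in> edges P - {n} \<times> insert s R" for m u
      using search_invD(8)[OF si that] .
  qed (use search_invD(1-5)[OF si] sn in simp_all)
  moreover have "frontier ?\<sigma> n"
    using fr unfolding frontier_def eq fval_def .
  \<comment> \<open>Either \<theta> is \<open>first (n, s)\<close> or that estimator was applied
    earlier, so the second disjunct holds from now on.\<close>
  moreover have "estimation_inv ?\<sigma> (n, s) (ratio gu' gl') gl' gu' r"
    using es gl' gu' r unfolding estimation_inv_def eq
    by (auto simp: get_estimator_def \<sigma>' split: option.splits)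
  ultimately show ?thesis using R by simp
qed

text \<open>Consistency makes the f-values of the closed nodes minimal, which prevents reopening.\<close>

lemma gmin_closed_le:
  assumes si: "search_inv \<sigma> U V" and fr: "frontier \<sigma> n" and s: "s \<in> clsd \<sigma>"
    and e: "(n, s) \<in> edges P"
    and w: "ereal (\<alpha> (n, s)) \<le> w"
  shows "gmin \<sigma> s \<le> gmin \<sigma> n + w"
proof -
  have "n \<in> clsd \<sigma>" using fr by (simp add: frontier_def)
  then have fin: "\<bar>gmin \<sigma> n\<bar> \<noteq> \<infinity>" "\<bar>gmin \<sigma> s\<bar> \<noteq> \<infinity>"
    using search_inv_node(2,3)[OF si] s by auto
  \<comment> \<open>Both values are finite, so the comparison of f-values can be rearranged in the
    reals.\<close>
  then obtain gn gs where g: "gmin \<sigma> n = ereal gn" "gmin \<sigma> s = ereal gs" by auto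
  have "f \<sigma> s \<le> f \<sigma> n" using fr s by (auto simp: frontier_def)
  then have "gs + h \<alpha> s \<le> gn + h \<alpha> n" by (simp add: fval_def g)
  then have "gs \<le> gn + \<alpha> (n, s)" using heuristic_edge[OF e] by simp
  then have "ereal gs \<le> ereal gn + ereal (\<alpha> (n, s))" by simp
  also have "\<dots> \<le> ereal gn + w" using w by (rule add_left_mono)
  finally show ?thesis by (simp add: g)
qed

text \<open>Ensures that a node inserted into OPEN does not fall below the f-value of the node being
  expanded.\<close>

lemma f_successor_ge:
  assumes "(n, s) \<in> edges P" "ereal (\<alpha> (n, s)) \<le> w"
  shows "f \<sigma> n \<le> gmin \<sigma> n + w + ereal (h \<alpha> s)"
proof -
  have "ereal (h \<alpha> n) \<le> ereal (\<alpha> (n, s)) + ereal (h \<alpha> s)"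
    using heuristic_edge[OF assms(1)] by simp
  also have "\<dots> \<le> w + ereal (h \<alpha> s)" using assms(2) by (rule add_right_mono)
  finally show ?thesis by (simp add: fval_def add.assoc add_left_mono)
qed

text \<open>Before the first estimation the ratio is infinite and an estimator is pending, so
  neither exit condition can hold then.\<close>

lemma estimation_applied:
  assumes "estimation_inv \<sigma> (n, s) \<eta> gl gu r" "\<eta> \<le> ereal \<epsilon> \<or> r = None"
  shows "first (n, s) \<in> applied \<sigma> (n, s)"
    "gl = gmin \<sigma> n + tightest_min P (applied \<sigma> (n, s))"
    "gu = gmax \<sigma> n + tightest_max P (applied \<sigma> (n, s))" "\<eta> = ratio gu gl"
  using assms by (auto simp: estimation_inv_def)

text \<open>The final \<open>gl\<close> includes at least the first lower bound of the edge, so by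
  consistency it cannot undercut a closed node.\<close>

lemma improved_not_closed:
  assumes inv: "config_inv (Estimate \<sigma> n R s \<eta> gl gu r)"
    and "\<eta> \<le> ereal \<epsilon> \<or> r = None" "gl < gmin \<sigma> s"
  shows "s \<notin> clsd \<sigma>"
proof
  assume "s \<in> clsd \<sigma>"
  moreover have e: "(n, s) \<in> edges P" "applied \<sigma> (n, s) \<subseteq> estimators P (n, s)"
    using inv by (auto simp: estimation_inv_def)
  moreover have es: "estimation_inv \<sigma> (n, s) \<eta> gl gu r" using inv by simp
  ultimately have "gmin \<sigma> s \<le> gl"
    using inv tightest_bounds(1)[OF e estimation_applied(1)[OF es assms(2)]]
      estimation_applied(2)[OF es assms(2)] gmin_closed_le[of \<sigma> _ _ n s] by auto
  then show False using assms(3) by simp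
qed

text \<open>\<open>C\<close> is the true cost of a plan traced back from \<open>n\<close>. On
  exhaustion the path and the edge are bounded separately by \<epsilon> times their lower bounds; on
  a small ratio the bound passes through \<open>gu\<close>.\<close>

lemma estimated_cost_le:
  assumes es: "estimation_inv \<sigma> (n, s) \<eta> gl gu r" and stop: "\<eta> \<le> ereal \<epsilon> \<or> r = None"
    and n: "0 \<le> gmin \<sigma> n" "gmin \<sigma> n < \<infinity>"
    and C: "C \<le> gmax \<sigma> n" "C \<le> ereal \<epsilon> * gmin \<sigma> n"
  shows "C + edge_cost P (n, s) \<le> gu" "C + edge_cost P (n, s) \<le> ereal \<epsilon> * gl"
proof -
  let ?T = "applied \<sigma> (n, s)"
  have e: "(n, s) \<in> edges P" "?T \<subseteq> estimators P (n, s)"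
    using es by (auto simp: estimation_inv_def)
  note app = estimation_applied[OF es stop]
  note tb = tightest_bounds[OF e app(1)]
  show le_gu: "C + edge_cost P (n, s) \<le> gu"
    unfolding app(3) using C(1) tb(4) by (rule add_mono)
  show "C + edge_cost P (n, s) \<le> ereal \<epsilon> * gl"
  proof (cases "r = None")
    case True
    then have "?T = estimators P (n, s)"
      using es by (auto simp: estimation_inv_def get_estimator_def)
    then have "edge_cost P (n, s) \<le> ereal \<epsilon> * tightest_min P ?T"
      using edge_cost_le_edge_min[OF e(1)] by (simp add: edge_min_def)
    then have "C + edge_cost P (n, s) \<le> ereal \<epsilon> * gmin \<sigma> n + ereal \<epsilon> * tightest_min P ?T"
      using C(2) by (intro add_mono)
    then show ?thesis
      using n tb(2) by (simp add: app(2) ereal_right_distrib)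
  next
    case False
    then have \<eta>: "ratio gu gl \<le> ereal \<epsilon>" using stop app(4) by blast
    have gl: "0 \<le> gl" using n tb(2) by (simp add: app(2))
    show ?thesis
    proof (cases "gl = 0")
      case True
      \<comment> \<open>The ratio is 1 by convention here and says nothing about \<open>gu\<close>.
        Instead both lower bounds vanish, which forces \<open>C\<close> \<le> 0 and edge cost
        0.\<close>
      then have "gmin \<sigma> n = 0" "tightest_min P ?T = 0"
        using add_nonneg_eq_0_iff[OF n(1) tb(2)] app(2) by auto
      then show ?thesis using C(2) tb(5) True by simp
    next
      case False
      then have "0 < gl" using gl by simp
      moreover have "gl < \<infinity>"
        using n(2) tb(3) edge_cost_bounds(2)[OF domain e(1)] by (auto simp: app(2))
      ultimately have "gu \<le> ereal \<epsilon> * gl"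
        using \<eta> False ereal_divide_le_pos[of gl gu "ereal \<epsilon>"] by (simp add: ratio_def mult.commute)
      then show ?thesis using le_gu by (rule order_trans[rotated])
    qed
  qed
qed

lemma improve_inv:
  assumes inv: "config_inv (Estimate \<sigma> n R s \<eta> gl gu r)"
    and stop: "\<eta> \<le> ereal \<epsilon> \<or> r = None" and less: "gl < gmin \<sigma> s"
  shows "config_inv (Successors
              (\<sigma>\<lparr>gmin := (gmin \<sigma>)(s := gl), gmax := (gmax \<sigma>)(s := gu), parent := (parent \<sigma>)(s := n),
                 opn := insert s (opn \<sigma>), clsd := clsd \<sigma> - {s}\<rparr>) n R)"
    (is "config_inv (Successors ?\<sigma> n R)")
proof -
  have si: "search_inv \<sigma> ({n} \<times> R) ({n} \<times> insert s R)" and fr: "frontier \<sigma> n"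
    and R: "R \<subseteq> {s. (n, s) \<in> edges P}" "s \<notin> R"
    and es: "estimation_inv \<sigma> (n, s) \<eta> gl gu r" using inv by auto
  have n: "n \<in> clsd \<sigma>" using fr by (simp add: frontier_def)
  have s: "s \<notin> clsd \<sigma>" using improved_not_closed[OF inv stop less] .
  have e: "(n, s) \<in> edges P" "applied \<sigma> (n, s) \<subseteq> estimators P (n, s)"
    using es by (auto simp: estimation_inv_def)
  note app = estimation_applied[OF es stop]
  note tb = tightest_bounds[OF e app(1)]
  have gn: "0 \<le> gmin \<sigma> n" "gmin \<sigma> n < \<infinity>" using search_inv_node[OF si] n by auto
  have gl: "0 \<le> gl" "gl < \<infinity>" "gl \<le> gmin \<sigma> n + edge_cost P (n, s)"
    using gn tb(2,3) less by (auto simp: app(2) intro: add_left_mono)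
  \<comment> \<open>The initial state has \<open>gmin\<close> 0, which a nonnegative bound cannot
    improve, so its plan stays the empty one.\<close>
  have init: "s \<noteq> init_state P"
    using less gl(1) si by (auto simp: search_inv_def)
  have cl: "clsd ?\<sigma> = clsd \<sigma>" using s by auto
  have old: "sound_node ?\<sigma> m" if "m \<in> opn \<sigma> \<union> clsd \<sigma>" "m \<noteq> s" for m
    by (rule sound_node_cong[OF si that(1), where X = "{s}"]) (use that s in auto)
  have sn: "sound_node ?\<sigma> n" using old n s by auto
  have gn': "gmin ?\<sigma> n = gmin \<sigma> n" "gmax ?\<sigma> n = gmax \<sigma> n" using n s by auto
  have new: "sound_node ?\<sigma> s"
    unfolding sound_node_def
  proof (intro conjI allI impI)
    show "0 \<le> gmin ?\<sigma> s" "gmin ?\<sigma> s < \<infinity>" using gl by auto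
    show "parent ?\<sigma> s \<in> clsd ?\<sigma>" using n s by auto
    obtain \<pi> a where "traced_plan P ?\<sigma> n \<pi>" "induces P n a s"
      using sn e(1) by (auto simp: sound_node_def edges_def)
    then have "traced_plan P ?\<sigma> s (\<pi> @ [a])"
      using init by (intro traced_plan.trace_back) auto
    then show "\<exists>\<pi>. traced_plan P ?\<sigma> s \<pi>" ..
  next
    fix \<pi> assume "traced_plan P ?\<sigma> s \<pi>"
    then obtain \<pi>' a where \<pi>: "\<pi> = \<pi>' @ [a]" "traced_plan P ?\<sigma> n \<pi>'" "induces P n a s"
      using init by (auto elim: traced_plan.cases)
    then have C: "leads_to P (init_state P) \<pi>' n" "plan_cost P \<pi>' \<le> gmax \<sigma> n"
      "plan_cost P \<pi>' \<le> ereal \<epsilon> * gmin \<sigma> n"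
      using sn gn' unfolding sound_node_def by metis+
    have "plan_cost P \<pi> = plan_cost P \<pi>' + edge_cost P (n, s)"
      using edge_cost_eq[OF domain \<pi>(3)] by (simp add: \<pi>(1) plan_cost_def)
    then show "plan_cost P \<pi> \<le> gmax ?\<sigma> s" "plan_cost P \<pi> \<le> ereal \<epsilon> * gmin ?\<sigma> s"
      using estimated_cost_le[OF es stop gn C(2,3)] by auto
    show "leads_to P (init_state P) \<pi> s"
      using leads_to_append[OF C(1) \<pi>(3)] \<pi>(1) by simp
  qed
  \<comment> \<open>Lowering \<open>gmin\<close> at \<open>s\<close> only helps on the left, and
    \<open>s\<close> is not closed, so it never occurs as \<open>m\<close>. The new edge is covered
    because its lower bound is at most its true cost.\<close>
  have succ: "\<forall>m\<in>clsd \<sigma>. \<forall>u. (m, u) \<in> edges P - {n} \<times> R \<longrightarrow>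
        u \<in> insert s (opn \<sigma>) \<union> clsd \<sigma> \<and> gmin ?\<sigma> u \<le> gmin ?\<sigma> m + edge_cost P (m, u)"
  proof (intro ballI allI impI)
    fix m u assume m: "m \<in> clsd \<sigma>" and mu: "(m, u) \<in> edges P - {n} \<times> R"
    have ms: "m \<noteq> s" using m s by auto
    show "u \<in> insert s (opn \<sigma>) \<union> clsd \<sigma> \<and> gmin ?\<sigma> u \<le> gmin ?\<sigma> m + edge_cost P (m, u)"
    proof (cases "m = n \<and> u = s")
      case True
      then show ?thesis using gl(3) ms by auto
    next
      case False
      then have "u \<in> opn \<sigma> \<union> clsd \<sigma>" "gmin \<sigma> u \<le> gmin \<sigma> m + edge_cost P (m, u)"
        using si m mu unfolding search_inv_def by auto
      then show ?thesis using ms less by auto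
    qed
  qed
  have "search_inv ?\<sigma> ({n} \<times> R) ({n} \<times> R)"
    unfolding search_inv_def cl
    using si old new succ s init edge_in_states[OF domain e(1)]
    unfolding search_inv_def by auto
  moreover have "frontier ?\<sigma> n"
  proof -
    have "f ?\<sigma> m = f \<sigma> m" if "m \<noteq> s" for m using that by (simp add: fval_def)
    moreover have "n \<noteq> s" using n s by auto
    moreover have "f \<sigma> n \<le> f ?\<sigma> s"
      using f_successor_ge[OF e(1) tb(1)] by (simp add: fval_def app(2))
    ultimately show ?thesis
      using fr s unfolding frontier_def cl by force
  qed
  ultimately show ?thesis using R by simp
qed

text \<open>Rejection means \<open>gmin\<close> at \<open>s\<close> is at most \<open>gl\<close>,
  hence at most \<open>gmin \<sigma> n\<close> plus the true edge cost. As this is finite,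
  \<open>s\<close> is not a fresh node with value infinity.\<close>

lemma reject_inv:
  assumes inv: "config_inv (Estimate \<sigma> n R s \<eta> gl gu r)" and less: "\<not> gl < gmin \<sigma> s"
  shows "config_inv (Successors \<sigma> n R)"
proof -
  have si: "search_inv \<sigma> ({n} \<times> R) ({n} \<times> insert s R)" and fr: "frontier \<sigma> n"
    and es: "estimation_inv \<sigma> (n, s) \<eta> gl gu r" using inv by auto
  have e: "(n, s) \<in> edges P" "applied \<sigma> (n, s) \<subseteq> estimators P (n, s)"
    using es by (auto simp: estimation_inv_def)
  have gn: "0 \<le> gmin \<sigma> n" "gmin \<sigma> n < \<infinity>"
    using search_inv_node[OF si] fr by (auto simp: frontier_def)
  have gl: "gl \<le> gmin \<sigma> n + edge_cost P (n, s)"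
    using es tightest_bounds(3)[OF e] gn edge_cost_bounds(1)[OF domain e(1)]
    by (auto simp: estimation_inv_def intro: add_left_mono)
  also have "\<dots> < \<infinity>" using gn edge_cost_bounds[OF domain e(1)] by auto
  finally have "gl < \<infinity>" .
  then have "s \<in> opn \<sigma> \<union> clsd \<sigma>" "gmin \<sigma> s \<le> gmin \<sigma> n + edge_cost P (n, s)"
    using es less gl by (auto simp: estimation_inv_def)
  then have "search_inv \<sigma> ({n} \<times> R) ({n} \<times> R)"
    using si unfolding search_inv_def by auto
  then show ?thesis using inv by simp
qed

lemma step_inv:
  assumes "asec_step P \<epsilon> first h x y" "config_inv x"
  shows "config_inv y"
  using assms
proof (cases rule: asec_step.cases)
  case (no_plan \<sigma>)
  \<comment> \<open>A solution forces a node in OPEN, so this step cannot occur.\<close>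
  then show ?thesis using assms(2) best_below_solution[of \<sigma>] solvable by auto
next
  case (goal \<sigma> n \<pi>)
  then show ?thesis using assms(2) returned_plan_eps_optimal by auto
next
  case (expand \<sigma> n)
  then show ?thesis using assms(2) expand_inv by blast
next
  case (end_succ \<sigma> n)
  \<comment> \<open>With no successors left \<open>U\<close> and \<open>V\<close> are empty, and f
    at \<open>n\<close> separates CLOSED from OPEN.\<close>
  then show ?thesis using assms(2) by (auto simp: frontier_def intro: order_trans)
next
  case (next_succ s R \<sigma>' \<sigma> n r gu)
  then show ?thesis using assms(2) next_succ_inv by blast
next
  case (estimate \<eta> gl \<sigma> s \<sigma>' n \<theta> gl' gu' r R gu)
  then show ?thesis using assms(2) estimate_inv by blast
next
  case (improve \<eta> r gl \<sigma> s n R gu)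
  then show ?thesis using assms(2) improve_inv by blast
next
  case (reject gl \<sigma> s n R \<eta> gu r)
  then show ?thesis using assms(2) reject_inv by blast
qed

lemma reachable_inv:
  assumes "(asec_step P \<epsilon> first h)\<^sup>*\<^sup>* x y" "config_inv x"
  shows "config_inv y"
  using assms by (induction rule: rtranclp_induct) (auto intro: step_inv)

section \<open>Progress and termination\<close>

text \<open>The only way to get stuck would be a first request whose prescribed answer has already
  been applied.\<close>

lemma get_estimator_total:
  "e \<in> asked \<sigma> \<or> first e \<in> estimators P e - applied \<sigma> e \<Longrightarrow> \<exists>r. get_estimator P first \<sigma> e r"
proof (cases "e \<in> asked \<sigma>")
  case True
  show ?thesis
  proof (cases "estimators P e - applied \<sigma> e = {}")
    case True
    then have "get_estimator P first \<sigma> e None" by (simp add: get_estimator_def)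
    then show ?thesis ..
  next
    case False
    then obtain \<theta> where "\<theta> \<in> estimators P e - applied \<sigma> e" by blast
    then have "get_estimator P first \<sigma> e (Some \<theta>)" using True by (simp add: get_estimator_def)
    then show ?thesis ..
  qed
next
  case False
  assume "e \<in> asked \<sigma> \<or> first e \<in> estimators P e - applied \<sigma> e"
  then have "get_estimator P first \<sigma> e (Some (first e))"
    using False by (simp add: get_estimator_def)
  then show ?thesis ..
qed

text \<open>Makes every halting configuration a \<open>Return\<close>, where the invariant yields
  the result.\<close>

lemma progress:
  assumes inv: "config_inv x" and x: "\<And>p b. x \<noteq> Return p b"
  shows "\<exists>y. asec_step P \<epsilon> first h x y"
proof (cases x)
  case (Main \<sigma>)
  then have si: "search_inv \<sigma> {} {}" using inv by simp
  show ?thesis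
  proof (cases "opn \<sigma> = {}")
    case True
    then show ?thesis using Main no_plan by blast
  next
    case False
    have "finite (opn \<sigma>)"
      using si finite_states by (auto simp: search_inv_def intro: finite_subset)
    then have "best P first h \<sigma> (arg_min_on (f \<sigma>) (opn \<sigma>))"
      using False arg_min_if_finite(1) arg_min_least unfolding best_def by metis
    then obtain n where n: "best P first h \<sigma> n" ..
    show ?thesis
    proof (cases "n \<in> goals P")
      case True
      \<comment> \<open>The \<open>goal\<close> rule requires a traced plan, whose existence is part
        of soundness.\<close>
      have "sound_node \<sigma> n" using n search_inv_node(1)[OF si] by (simp add: best_def)
      then obtain \<pi> where "traced_plan P \<sigma> n \<pi>" by (auto simp: sound_node_def)
      then show ?thesis using goal[OF n True] Main by blast
    next
      case False
      then show ?thesis using expand[OF n False] Main by blast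
    qed
  qed
next
  case (Successors \<sigma> n R)
  show ?thesis
  proof (cases "R = {}")
    case True
    then show ?thesis using Successors end_succ by metis
  next
    case False
    then obtain s where s: "s \<in> R" by blast
    let ?\<sigma> = "if s \<in> opn \<sigma> \<union> clsd \<sigma> then \<sigma> else \<sigma>\<lparr>gmin := (gmin \<sigma>)(s := \<infinity>)\<rparr>"
    have "(n, s) \<in> edges P" "applied \<sigma> (n, s) = {}"
      using inv s Successors by (auto simp: search_inv_def)
    moreover from this have "applied ?\<sigma> (n, s) = {}" by simp
    ultimately obtain r where "get_estimator P first ?\<sigma> (n, s) r"
      using get_estimator_total[of "(n, s)" ?\<sigma>] first by blast
    from next_succ[OF s refl this] show ?thesis unfolding Successors by blast
  qed
next
  case (Estimate \<sigma> n R s \<eta> gl gu r)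
  consider "\<not> gl < gmin \<sigma> s" | "gl < gmin \<sigma> s" "\<eta> \<le> ereal \<epsilon> \<or> r = None"
    | \<theta> where "gl < gmin \<sigma> s" "ereal \<epsilon> < \<eta>" "r = Some \<theta>"
    by (cases r) force+
  then show ?thesis
  proof cases
    case 1
    then show ?thesis using Estimate reject by metis
  next
    case 2
    then show ?thesis using Estimate improve by metis
  next
    case (3 \<theta>)
    let ?\<sigma> = "\<sigma>\<lparr>applied := (applied \<sigma>)((n, s) := insert \<theta> (applied \<sigma> (n, s)))\<rparr>"
    have "(n, s) \<in> asked \<sigma>" using inv Estimate by (auto simp: estimation_inv_def)
    then obtain r' where "get_estimator P first ?\<sigma> (n, s) r'"
      using get_estimator_total[of "(n, s)" ?\<sigma>] by auto
    then show ?thesis using estimate[OF 3(2,1) refl refl refl] unfolding Estimate 3(3) by blast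
  qed
next
  case (Return p b)
  then show ?thesis using x by blast
qed

text \<open>Lexicographic measure: nodes not closed, successors left, estimators left. The successor
  functions place \<open>Return\<close> below \<open>Main\<close>, \<open>Main\<close> below
  \<open>Successors\<close> with nothing left, and \<open>Estimate\<close> above the
  \<open>Successors\<close> with the same \<open>R\<close>.\<close>

fun rank :: "('s, 'a, 't) asec_config \<Rightarrow> nat \<times> nat \<times> nat" where
  "rank (Main \<sigma>) = (Suc (card (states P - clsd \<sigma>)), 0, 0)"
| "rank (Successors \<sigma> n R) = (Suc (card (states P - clsd \<sigma>)), Suc (card R), 0)"
| "rank (Estimate \<sigma> n R s \<eta> gl gu r) =
     (Suc (card (states P - clsd \<sigma>)), Suc (card R), Suc (card (estimators P (n, s) - applied \<sigma> (n, s))))"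
| "rank (Return p b) = (0, 0, 0)"

lemma rank_decreases:
  assumes "asec_step P \<epsilon> first h x y" "config_inv x"
  shows "(rank y, rank x) \<in> less_than <*lex*> less_than <*lex*> less_than"
  using assms
proof (cases rule: asec_step.cases)
  case (expand \<sigma> n)
  then have "n \<in> states P - clsd \<sigma>"
    using assms(2) by (auto simp: best_def search_inv_def)
  then have "card (states P - insert n (clsd \<sigma>)) < card (states P - clsd \<sigma>)"
    using finite_states by (intro psubset_card_mono) auto
  then show ?thesis using expand by simp
next
  case (next_succ s R \<sigma>' \<sigma> n r gu)
  have "R \<subseteq> states P"
    using assms(2) next_succ(1) edge_in_states[OF domain] by auto
  then have "finite R" using finite_states finite_subset by blast
  then have "card (R - {s}) < card R" using next_succ(3) by (rule card_Diff1_less)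
  moreover have "clsd \<sigma>' = clsd \<sigma>" using next_succ by simp
  ultimately show ?thesis using next_succ(1,2) by simp
next
  case (estimate \<eta> gl \<sigma> s \<sigma>' n \<theta> gl' gu' r R gu)
  then have e: "(n, s) \<in> edges P" "\<theta> \<in> estimators P (n, s) - applied \<sigma> (n, s)"
    using assms(2) by (auto simp: estimation_inv_def get_estimator_def)
  have "finite (estimators P (n, s))"
    using problem e(1) by (auto simp: is_est_problem_def are_cost_estimators_def)
  then have "card (estimators P (n, s) - insert \<theta> (applied \<sigma> (n, s))) < card (estimators P (n, s) - applied \<sigma> (n, s))"
    using e(2) by (intro psubset_card_mono) auto
  then show ?thesis using estimate by simp
next
  case (improve \<eta> r gl \<sigma> s n R gu)
  \<comment> \<open>Without reopening, removing \<open>s\<close> from CLOSED changes nothing and the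
    first component stays equal.\<close>
  then have "s \<notin> clsd \<sigma>" using assms(2) improved_not_closed by blast
  then show ?thesis using improve by simp
qed auto

lemma terminates:
  assumes "config_inv (\<rho> 0)" "\<And>i::nat. asec_step P \<epsilon> first h (\<rho> i) (\<rho> (Suc i))"
  shows False
proof -
  have "config_inv (\<rho> i)" for i
    by (induction i) (use assms step_inv in auto)
  then have "(rank (\<rho> (Suc i)), rank (\<rho> i)) \<in> less_than <*lex*> less_than <*lex*> less_than" for i
    using rank_decreases assms(2) by blast
  moreover have "wf (less_than <*lex*> less_than <*lex*> (less_than :: (nat \<times> nat) set))" by auto
  ultimately show False
    unfolding wf_iff_no_infinite_down_chain by (elim notE, intro exI[of _ "\<lambda>i. rank (\<rho> i)"]) blast
qed

lemma guarantees:
  "guarantees_eps_optimal P \<epsilon> (asec_initial P) (asec_step P \<epsilon> first h) asec_result"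
  unfolding guarantees_eps_optimal_def
proof (intro conjI allI impI notI)
  assume "\<exists>\<rho>. asec_initial P (\<rho> 0) \<and> (\<forall>i. asec_step P \<epsilon> first h (\<rho> i) (\<rho> (Suc i)))"
  then show False using terminates initial_config_inv by blast
next
  fix x y
  assume a: "asec_initial P x \<and> (asec_step P \<epsilon> first h)\<^sup>*\<^sup>* x y \<and> \<not> (\<exists>z. asec_step P \<epsilon> first h y z)"
  then have "config_inv y" using reachable_inv initial_config_inv by blast
  moreover from this obtain p b where "y = Return p b" using a progress by blast
  ultimately show "\<exists>\<pi>. asec_result y = Some \<pi> \<and> eps_optimal P \<epsilon> \<pi>" by simp
qed

end

theorem theorem4:
  fixes P :: "('s, 'a, 't) est_problem" and \<epsilon> :: real
    and h :: "'s param_heuristic" and first :: "'s \<times> 's \<Rightarrow> 't"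
  assumes "is_est_problem P"
    and "1 \<le> \<epsilon>"
    and "\<forall>e\<in>edges P. (0 < edge_min P e \<and> edge_max P e / edge_min P e \<le> ereal \<epsilon>)
                     \<or> (edge_min P e = 0 \<and> edge_cost P e = 0)"
    and "consistent P h"
    and "\<forall>e\<in>edges P. first e \<in> estimators P e"
  shows "eps_complete P \<epsilon> (asec_initial P) (asec_step P \<epsilon> first h) asec_result"
  unfolding eps_complete_def
proof
  assume "\<exists>\<pi>. verifiably_eps_optimal P \<epsilon> \<pi>"
  then obtain \<pi> where "\<And>c. is_est_problem (P\<lparr>cost := c\<rparr>) \<Longrightarrow> eps_optimal (P\<lparr>cost := c\<rparr>) \<epsilon> \<pi>"
    by (auto simp: verifiably_eps_optimal_def)
  \<comment> \<open>The true cost function is among those compatible with the estimators.\<close>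
  from this[of "cost P"] have "solution P \<pi>"
    using assms(1) by (simp add: eps_optimal_def)
  then interpret solvable_estimation P \<epsilon> h first
    using assms by unfold_locales auto
  show "guarantees_eps_optimal P \<epsilon> (asec_initial P) (asec_step P \<epsilon> first h) asec_result"
    by (rule guarantees)
qed

end
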